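(* Assume $2^{\aleph_1}=\aleph_2$. Then there exist two Hausdorff Lindelöf Whyburn $P$-spaces whose product is not Whyburn.
   Context: A $P$-space is a topological space in which every $G_\delta$ set is open. A set $F\subseteq X$ is an almost closed set converging to $x\in X$, written $F\to x$, if $\overline{F}\setminus F=\{x\}$. A space $X$ is Whyburn if for each non-closed set $A\subseteq X$ and each point $x\in\overline{A}\setminus A$ there is $F\subseteq A$ with $F\to x$. A space is Lindelöf if every open cover has a countable subcover. *)

theory Defs
  imports "HOL-Analysis.Analysis"
begin

definition P_space :: "'a topology \<Rightarrow> bool" where
  "P_space X \<longleftrightarrow> (\<forall>G. gdelta_in X G \<longrightarrow> openin X G)"

definition almost_closed_to :: "'a topology \<Rightarrow> 'a set \<Rightarrow> 'a \<Rightarrow> bool" where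
  "almost_closed_to X F x \<longleftrightarrow> F \<subseteq> topspace X \<and> (X closure_of F) - F = {x}"

definition Whyburn_space :: "'a topology \<Rightarrow> bool" where
  "Whyburn_space X \<longleftrightarrow>
    (\<forall>A. A \<subseteq> topspace X \<and> \<not> closedin X A \<longrightarrow>
      (\<forall>x \<in> (X closure_of A) - A. \<exists>F. F \<subseteq> A \<and> almost_closed_to X F x))"

(* cardSuc maps cardinals on 'a to cardinals on 'a set. In ZFC the type nat set set has at least
   aleph_2 elements; as a topology may have any subset of its type as its underlying set, every
   space with at most aleph_2 points has a homeomorphic copy of type nat set set topology. *)
abbreviation aleph1 :: "nat set rel" where
  "aleph1 \<equiv> cardSuc natLeq"

abbreviation aleph2 :: "nat set set rel" where
  "aleph2 \<equiv> cardSuc aleph1"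

end

theory Submission
  imports Defs "HOL-Library.Countable_Set_Type"
begin

text \<open>The construction lifts Simon's product of two compact Frechet spaces by one cardinal. An almost
  disjoint family \<open>\<A>\<close> of uncountable subsets of \<open>\<omega>\<^sub>1\<close> yields a Lindelof P-space with isolated points
  \<open>\<omega>\<^sub>1\<close>, a point for each \<open>A \<in> \<A>\<close> to which \<open>A\<close> converges modulo countable sets, and a point at
  infinity whose neighbourhoods are co-small for the \<open>\<sigma>\<close>-ideal generated by \<open>\<A>\<close>. This space is
  Whyburn as soon as every set outside the \<open>\<sigma>\<close>-ideal contains an uncountable set almost disjoint from
  \<open>\<A>\<close>. If \<open>\<A>\<close> and \<open>\<B>\<close> both have this property while \<open>\<A> \<union> \<B>\<close> is maximal almost disjoint, then the
  diagonal of \<open>\<omega>\<^sub>1\<close> accumulates at the pair of points at infinity, but each uncountable part of it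
  also accumulates at some \<open>(A, \<infinity>)\<close> or \<open>(\<infinity>, B)\<close>.

  Such a pair is built by recursion over the \<open>2\<^bsup>\<omega>\<^sub>1\<^esup> = \<omega>\<^sub>2\<close> subsets \<open>S\<close> of \<open>\<omega>\<^sub>1\<close>: at most \<open>\<omega>\<^sub>1\<close> sets have been
  chosen before \<open>S\<close>, so if \<open>S\<close> is outside their \<open>\<sigma>\<close>-ideal, a diagonalisation gives two disjoint
  uncountable subsets of \<open>S\<close> almost disjoint from all of them; one goes into \<open>\<A>\<close>, the other into
  \<open>\<B>\<close>.\<close>

unbundle cardinal_syntax
no_notation elt_set_eq (infix "=o" 50)

section \<open>Almost disjoint families of uncountable sets\<close>

text \<open>This is the \<sigma>-ideal generated by \<open>\<A>\<close> and the countable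
  sets.\<close>

definition sigma_ideal :: "'a set set \<Rightarrow> 'a set set" where
  "sigma_ideal \<A> = {S. \<exists>\<C>\<subseteq>\<A>. countable \<C> \<and> countable (S - \<Union>\<C>)}"

lemma sigma_idealI:
  "\<C> \<subseteq> \<A> \<Longrightarrow> countable \<C> \<Longrightarrow> countable (S - \<Union>\<C>) \<Longrightarrow> S \<in> sigma_ideal \<A>"
  unfolding sigma_ideal_def by blast

lemma sigma_idealE:
  assumes "S \<in> sigma_ideal \<A>"
  obtains \<C> where "\<C> \<subseteq> \<A>" "countable \<C>" "countable (S - \<Union>\<C>)"
  using assms unfolding sigma_ideal_def by blast

lemma sigma_ideal_subset:
  assumes "S \<in> sigma_ideal \<A>" "T \<subseteq> S"
  shows "T \<in> sigma_ideal \<A>"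
proof -
  obtain \<C> where C: "\<C> \<subseteq> \<A>" "countable \<C>" "countable (S - \<Union>\<C>)"
    using assms(1) by (rule sigma_idealE)
  have "T - \<Union>\<C> \<subseteq> S - \<Union>\<C>"
    using assms(2) by (rule Diff_mono) simp
  then show ?thesis
    by (rule sigma_idealI[OF C(1,2) countable_subset[OF _ C(3)]])
qed

lemma sigma_ideal_mono: "\<A> \<subseteq> \<B> \<Longrightarrow> sigma_ideal \<A> \<subseteq> sigma_ideal \<B>"
  unfolding sigma_ideal_def by auto

lemma countable_in_sigma_ideal: "countable S \<Longrightarrow> S \<in> sigma_ideal \<A>"
  by (rule sigma_idealI[of "{}"]) auto

lemma member_in_sigma_ideal: "A \<in> \<A> \<Longrightarrow> A \<in> sigma_ideal \<A>"
  by (rule sigma_idealI[of "{A}"]) auto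

lemma sigma_ideal_UN:
  assumes "countable K" "\<And>k. k \<in> K \<Longrightarrow> S k \<in> sigma_ideal \<A>"
  shows "(\<Union>k\<in>K. S k) \<in> sigma_ideal \<A>"
proof -
  have "\<forall>k\<in>K. \<exists>\<C>. \<C> \<subseteq> \<A> \<and> countable \<C> \<and> countable (S k - \<Union>\<C>)"
    using assms(2) by (meson sigma_idealE)
  then obtain \<C> where C: "\<And>k. k \<in> K \<Longrightarrow> \<C> k \<subseteq> \<A> \<and> countable (\<C> k) \<and> countable (S k - \<Union>(\<C> k))"
    by metis
  have "countable (\<Union>k\<in>K. S k - \<Union>(\<C> k))"
    using assms(1) C by (intro countable_UN) auto
  then have "countable ((\<Union>k\<in>K. S k) - \<Union>(\<Union>k\<in>K. \<C> k))"
    by (rule countable_subset[rotated]) auto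
  moreover have "countable (\<Union>k\<in>K. \<C> k)" "(\<Union>k\<in>K. \<C> k) \<subseteq> \<A>"
    using assms(1) C by auto
  ultimately show ?thesis
    unfolding sigma_ideal_def by blast
qed

lemma sigma_ideal_Un: "S \<in> sigma_ideal \<A> \<Longrightarrow> T \<in> sigma_ideal \<A> \<Longrightarrow> S \<union> T \<in> sigma_ideal \<A>"
  using sigma_ideal_UN[of "{S, T}" "\<lambda>x. x"] by auto

text \<open>Covering sets that are missing from \<open>\<A>\<close> have only countable traces on
  \<open>S\<close>, so countably many of them can be absorbed into the countable remainder. This
  transfers smallness from one family to another.\<close>

lemma sigma_ideal_change:
  assumes "S \<in> sigma_ideal \<B>" "\<And>B. B \<in> \<B> \<Longrightarrow> B \<in> \<A> \<or> countable (B \<inter> S)"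
  shows "S \<in> sigma_ideal \<A>"
proof -
  obtain \<C> where C: "\<C> \<subseteq> \<B>" "countable \<C>" "countable (S - \<Union>\<C>)"
    using assms(1) by (rule sigma_idealE)
  have "(\<Union>B\<in>\<C>. B \<inter> S) \<in> sigma_ideal \<A>"
  proof (rule sigma_ideal_UN)
    show "B \<inter> S \<in> sigma_ideal \<A>" if "B \<in> \<C>" for B
      using assms(2)[of B] that C(1)
      by (metis Int_lower1 countable_in_sigma_ideal member_in_sigma_ideal sigma_ideal_subset subsetD)
  qed (rule C(2))
  then have "(\<Union>B\<in>\<C>. B \<inter> S) \<union> (S - \<Union>\<C>) \<in> sigma_ideal \<A>"
    by (rule sigma_ideal_Un) (rule countable_in_sigma_ideal[OF C(3)])
  then show ?thesis
    by (rule sigma_ideal_subset) auto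
qed

lemma sigma_ideal_countable:
  assumes "S \<in> sigma_ideal \<A>" "\<And>A. A \<in> \<A> \<Longrightarrow> countable (A \<inter> S)"
  shows "countable S"
  using sigma_ideal_change[OF assms(1), of "{}"] assms(2) by (auto simp: sigma_ideal_def)

locale almost_disjoint_family =
  fixes I :: "'a set" and \<A> :: "'a set set"
  assumes sub: "A \<in> \<A> \<Longrightarrow> A \<subseteq> I"
    and unc: "A \<in> \<A> \<Longrightarrow> uncountable A"
    and ad: "A \<in> \<A> \<Longrightarrow> B \<in> \<A> \<Longrightarrow> A \<noteq> B \<Longrightarrow> countable (A \<inter> B)"

section \<open>Construction of the two families\<close>

text \<open>Since \<open>S \<times> S\<close> is equipotent with \<open>S\<close>, a bijection
  carries the vertical sections of the square to pieces of \<open>S\<close>. Indexing by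
  \<open>S\<close> itself makes the pieces uncountably many.\<close>

lemma uncountable_split:
  assumes "uncountable S"
  obtains D where "disjoint_family_on D S" "\<And>x. x \<in> S \<Longrightarrow> D x \<subseteq> S" "\<And>x. x \<in> S \<Longrightarrow> uncountable (D x)"
proof -
  have "infinite S"
    using assms uncountable_infinite by blast
  then have "|S \<times> S| =o |S|"
    by (rule card_of_Times_same_infinite)
  then obtain h where h: "bij_betw h (S \<times> S) S"
    using card_of_ordIso by blast
  then have inj: "inj_on h (S \<times> S)" and im: "h ` (S \<times> S) = S"
    by (auto simp: bij_betw_def)
  show thesis
  proof
    show "disjoint_family_on (\<lambda>x. h ` ({x} \<times> S)) S"
      unfolding disjoint_family_on_def
      using inj by (auto dest: inj_onD)
    show "h ` ({x} \<times> S) \<subseteq> S" if "x \<in> S" for x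
      using im that by blast
    show "uncountable (h ` ({x} \<times> S))" if "x \<in> S" for x
    proof
      assume "countable (h ` ({x} \<times> S))"
      moreover have "inj_on h ({x} \<times> S)"
        using inj that by (auto intro: inj_on_subset)
      ultimately have "countable ({x} \<times> S)"
        by (rule countable_image_inj_on)
      then have "countable (snd ` ({x} \<times> S))"
        by (rule countable_image)
      then show False
        using assms by auto
    qed
  qed
qed

section \<open>Initial segments of \<open>\<omega>\<^sub>1\<close>\<close>

lemma Card_order_aleph1: "Card_order aleph1"
  by (simp add: cardSuc_Card_order natLeq_Card_order)

text \<open>A proper initial segment of a cardinal is strictly smaller, and strictly below the
  successor of \<open>natLeq\<close> means at most \<open>natLeq\<close>.\<close>

lemma countable_underS_aleph1:
  assumes "x \<in> Field aleph1"
  shows "countable (underS aleph1 x)"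
proof -
  have "|underS aleph1 x| \<le>o natLeq"
    using card_of_underS[OF Card_order_aleph1 assms]
      cardSuc_ordLeq_ordLess[OF natLeq_Card_order card_of_Card_order] by blast
  then show ?thesis
    by (simp add: countable_card_le_natLeq)
qed

lemma uncountable_Field_aleph1: "uncountable (Field aleph1)"
proof
  assume "countable (Field aleph1)"
  then have "|Field aleph1| \<le>o natLeq"
    by (simp add: countable_card_le_natLeq)
  then have "aleph1 \<le>o natLeq"
    using card_of_Field_ordIso[OF Card_order_aleph1] ordIso_ordLeq_trans ordIso_symmetric by blast
  then show False
    using cardSuc_greater[OF natLeq_Card_order] not_ordLess_ordLeq by blast
qed

lemma wf_Card_order: "Card_order r \<Longrightarrow> wf (r - Id)"
  by (simp add: card_order_on_def well_order_on_def)

text \<open>Diagonalisation: \<open>\<A>\<close> is enumerated along \<open>aleph1\<close>, and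
  stage \<open>x\<close> picks a point of \<open>B\<close> outside the sets enumerated earlier and
  different from the points picked earlier. Only countably many sets and points are forbidden at a
  stage, and they cannot cover \<open>B\<close>, which lies outside the ideal.\<close>

lemma almost_disjoint_extension:
  fixes \<A> :: "'a set set"
  assumes card: "|\<A>| \<le>o aleph1" and B: "B \<notin> sigma_ideal \<A>"
  obtains F where "F \<subseteq> B" "uncountable F" "\<And>A. A \<in> \<A> \<Longrightarrow> countable (A \<inter> F)"
proof (cases "\<A> = {}")
  \<comment> \<open>The empty family is treated apart because it has no enumeration by
    \<open>Field aleph1\<close>.\<close>
  case True
  then show thesis
    using that[of B] B countable_in_sigma_ideal by blast
next
  case False
  have "|\<A>| \<le>o |Field aleph1|"
    by (rule ordLeq_ordIso_trans[OF card ordIso_symmetric[OF card_of_Field_ordIso[OF Card_order_aleph1]]])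
  then obtain e where e: "e ` Field aleph1 = \<A>"
    using iffD2[OF card_of_ordLeq2[OF False]] by metis
  \<comment> \<open>Removing the earlier values of \<open>f\<close> makes \<open>f\<close>
    injective, so that its range is uncountable.\<close>
  define P where "P f x y \<longleftrightarrow>
    x \<in> Field aleph1 \<longrightarrow> y \<in> B - (\<Union>z\<in>underS aleph1 x. e z) - f ` underS aleph1 x"
    for f :: "nat set \<Rightarrow> 'a" and x y
  have "\<exists>f. \<forall>x. P f x (f x)"
  proof (rule dependent_wf_choice[of "aleph1 - Id" P])
    show "wf (aleph1 - Id)"
      by (rule wf_Card_order[OF Card_order_aleph1])
    show "P f x y = P g x y" if "\<And>z. (z, x) \<in> aleph1 - Id \<Longrightarrow> f z = g z" for f g x y
    proof -
      have "f ` underS aleph1 x = g ` underS aleph1 x"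
        using that by (intro image_cong) (auto simp: underS_def)
      then show ?thesis
        by (simp add: P_def)
    qed
    show "\<exists>y. P f x y" for f x
    proof (cases "x \<in> Field aleph1")
      case True
      let ?U = "underS aleph1 x"
      have "(\<Union>z\<in>?U. e z) \<union> f ` ?U \<in> sigma_ideal \<A>"
      proof (rule sigma_ideal_Un)
        show "(\<Union>z\<in>?U. e z) \<in> sigma_ideal \<A>"
        proof (rule sigma_ideal_UN)
          show "e z \<in> sigma_ideal \<A>" if "z \<in> ?U" for z
          proof (rule member_in_sigma_ideal)
            show "e z \<in> \<A>"
              unfolding e[symmetric] by (rule imageI, rule underS_Field[OF that])
          qed
        qed (rule countable_underS_aleph1[OF True])
        show "f ` ?U \<in> sigma_ideal \<A>"
          by (intro countable_in_sigma_ideal countable_image countable_underS_aleph1[OF True])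
      qed
      then have "\<not> B \<subseteq> (\<Union>z\<in>?U. e z) \<union> f ` ?U"
        using B by (metis sigma_ideal_subset)
      then show ?thesis
        unfolding P_def by blast
    qed (simp add: P_def)
  qed
  then obtain f where f: "\<And>x. x \<in> Field aleph1 \<Longrightarrow>
      f x \<in> B - (\<Union>z\<in>underS aleph1 x. e z) - f ` underS aleph1 x"
    unfolding P_def by blast
  have total: "x \<in> underS aleph1 y \<or> y \<in> underS aleph1 x"
    if "x \<in> Field aleph1" "y \<in> Field aleph1" "x \<noteq> y" for x y
    using Card_order_aleph1 that
    unfolding card_order_on_def well_order_on_def linear_order_on_def total_on_def underS_def
    by auto
  show thesis
  proof
    show "f ` Field aleph1 \<subseteq> B"
      using f by auto
    have "inj_on f (Field aleph1)"
      using f total by (intro inj_onI) (metis DiffD2 imageI)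
    then show "uncountable (f ` Field aleph1)"
      using uncountable_Field_aleph1 by (metis countable_image_inj_on)
    show "countable (A \<inter> f ` Field aleph1)" if A: "A \<in> \<A>" for A
    proof -
      obtain z where z: "z \<in> Field aleph1" "A = e z"
        using A e by blast
      \<comment> \<open>Points picked after stage \<open>z\<close> avoid \<open>e z\<close>, so the
        intersection comes from the countably many stages up to \<open>z\<close>.\<close>
      have "A \<inter> f ` Field aleph1 \<subseteq> f ` insert z (underS aleph1 z)"
        using f total z by blast
      moreover have "countable (f ` insert z (underS aleph1 z))"
        using countable_underS_aleph1[OF z(1)] by simp
      ultimately show ?thesis
        by (rule countable_subset)
    qed
  qed
qed

text \<open>Almost disjointness passes to subsets, so a single extension can be split into disjoint
  uncountable pieces, of which two are kept.\<close>

lemma almost_disjoint_extension_pair: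
  fixes \<A> :: "'a set set"
  assumes "|\<A>| \<le>o aleph1" "B \<notin> sigma_ideal \<A>"
  obtains F G where "F \<subseteq> B" "G \<subseteq> B" "F \<inter> G = {}" "uncountable F" "uncountable G"
    "\<And>A. A \<in> \<A> \<Longrightarrow> countable (A \<inter> F)" "\<And>A. A \<in> \<A> \<Longrightarrow> countable (A \<inter> G)"
proof -
  obtain H where H: "H \<subseteq> B" "uncountable H" "\<And>A. A \<in> \<A> \<Longrightarrow> countable (A \<inter> H)"
    using almost_disjoint_extension[OF assms] by metis
  obtain D where D: "disjoint_family_on D H" "\<And>x. x \<in> H \<Longrightarrow> D x \<subseteq> H" "\<And>x. x \<in> H \<Longrightarrow> uncountable (D x)"
    using uncountable_split[OF H(2)] by metis
  obtain x where x: "x \<in> H"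
    using H(2) by fastforce
  obtain y where y: "y \<in> H" "y \<noteq> x"
    using H(2) by (metis countable_empty countable_insert insertCI subsetI subset_singletonD)
  show thesis
  proof
    show "D x \<subseteq> B" "D y \<subseteq> B" "uncountable (D x)" "uncountable (D y)"
      using D(2,3) H(1) x y by blast+
    show "D x \<inter> D y = {}"
      using D(1) x y unfolding disjoint_family_on_def by blast
    show "countable (A \<inter> D x)" "countable (A \<inter> D y)" if "A \<in> \<A>" for A
      using H(3)[OF that] D(2)[OF x] D(2)[OF y(1)] by (meson Int_mono countable_subset order_refl)+
  qed
qed

text \<open>The cardinal hypothesis gives the power set of \<open>\<omega>\<^sub>1\<close> the size
  \<open>aleph2\<close>, so proper initial segments of its cardinal well-order have size at most
  \<open>aleph1\<close>. This bounds the number of earlier stages in the recursion over subsets; the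
  hypothesis does its work only here.\<close>

lemma card_of_underS_Pow:
  assumes "(BNF_Cardinal_Arithmetic.cexp BNF_Cardinal_Arithmetic.ctwo aleph1, aleph2) \<in> ordIso" "B \<subseteq> Field aleph1"
  shows "|underS |Pow (Field aleph1)| B| \<le>o aleph1"
proof -
  have "|Pow (Field aleph1)| =o BNF_Cardinal_Arithmetic.cexp BNF_Cardinal_Arithmetic.ctwo aleph1"
    unfolding BNF_Cardinal_Arithmetic.ctwo_def BNF_Cardinal_Arithmetic.cexp_def Field_card_of
    by (rule card_of_Pow_Func)
  then have iso: "|Pow (Field aleph1)| =o aleph2"
    using assms(1) by (rule ordIso_transitive)
  have "|underS |Pow (Field aleph1)| B| <o |Pow (Field aleph1)|"
    using assms(2) by (intro card_of_underS) (auto simp: Field_card_of card_of_card_order_on)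
  then have "|underS |Pow (Field aleph1)| B| <o aleph2"
    using iso by (rule ordLess_ordIso_trans)
  then show ?thesis
    using cardSuc_ordLeq_ordLess[OF Card_order_aleph1 card_of_Card_order] by blast
qed

lemma ex_nowhere_mad_pair:
  assumes "(BNF_Cardinal_Arithmetic.cexp BNF_Cardinal_Arithmetic.ctwo aleph1, aleph2) \<in> ordIso"
  obtains \<A> \<B> where "almost_disjoint_family (Field aleph1) (\<A> \<union> \<B>)" "\<A> \<inter> \<B> = {}"
    "Field aleph1 \<notin> sigma_ideal (\<A> \<union> \<B>)"
    "\<And>S. S \<subseteq> Field aleph1 \<Longrightarrow> S \<notin> sigma_ideal \<A> \<Longrightarrow> \<exists>B\<in>\<B>. uncountable (B \<inter> S)"
    "\<And>S. S \<subseteq> Field aleph1 \<Longrightarrow> S \<notin> sigma_ideal \<B> \<Longrightarrow> \<exists>A\<in>\<A>. uncountable (A \<inter> S)"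
proof -
  define I where "I = Field aleph1"
  define r where "r = |Pow I|"
  have I: "uncountable I" and cardI: "|I| =o aleph1"
    using uncountable_Field_aleph1 card_of_Field_ordIso[OF Card_order_aleph1] unfolding I_def by auto
  have r: "Card_order r" "Field r = Pow I"
    unfolding r_def by (simp_all add: card_of_card_order_on Field_card_of)
  \<comment> \<open>The disjoint pieces \<open>D x\<close> seed \<open>\<A>\<close> from the outset;
    being uncountably many, they keep \<open>I\<close> out of the final ideal.\<close>
  obtain D where D: "disjoint_family_on D I" "\<And>x. x \<in> I \<Longrightarrow> D x \<subseteq> I" "\<And>x. x \<in> I \<Longrightarrow> uncountable (D x)"
    using uncountable_split[OF I] by metis
  have D_disj: "D x \<inter> D y = {}" if "x \<in> I" "y \<in> I" "x \<noteq> y" for x y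
    using D(1) that unfolding disjoint_family_on_def by blast
  define fam where "fam f B = D ` I \<union> (fst \<circ> f) ` underS r B \<union> (snd \<circ> f) ` underS r B"
    for f :: "nat set set \<Rightarrow> nat set set \<times> nat set set" and B
  \<comment> \<open>Here \<open>fam f B\<close> is the seed together with all sets chosen before
    stage \<open>B\<close>. The clause \<open>B \<in> sigma_ideal (fam f B)\<close> permits a pair
    of empty sets when \<open>B\<close> is already small.\<close>
  define P where "P f B p \<longleftrightarrow> (B \<in> Pow I \<longrightarrow>
      fst p \<subseteq> B \<and> snd p \<subseteq> B \<and> fst p \<inter> snd p = {} \<and>
      (\<forall>A\<in>fam f B. countable (A \<inter> fst p) \<and> countable (A \<inter> snd p)) \<and>
      (B \<in> sigma_ideal (fam f B) \<or> uncountable (fst p) \<and> uncountable (snd p)))" for f B p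
  have "\<exists>f. \<forall>B. P f B (f B)"
  proof (rule dependent_wf_choice[of "r - Id" P])
    show "wf (r - Id)"
      by (rule wf_Card_order[OF r(1)])
    show "P f B p = P g B p" if "\<And>z. (z, B) \<in> r - Id \<Longrightarrow> f z = g z" for f g B p
    proof -
      have "fam f B = fam g B"
        unfolding fam_def using that by (intro arg_cong2[of _ _ _ _ "(\<union>)"] image_cong) (auto simp: underS_def)
      then show ?thesis
        by (simp add: P_def)
    qed
    show "\<exists>p. P f B p" for f B
    proof (cases "B \<in> Pow I \<and> B \<notin> sigma_ideal (fam f B)")
      case True
      have le: "|underS r B| \<le>o aleph1"
        using card_of_underS_Pow[OF assms, of B] True unfolding r_def I_def by auto
      have inf: "infinite (Field aleph1)"
        using uncountable_Field_aleph1 by (rule uncountable_infinite)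
      have "|fam f B| \<le>o aleph1"
        unfolding fam_def
        using inf Card_order_aleph1 ordLeq_transitive[OF card_of_image le]
          ordLeq_ordIso_trans[OF card_of_image cardI]
        by (intro card_of_Un_ordLeq_infinite_Field) auto
      then obtain F G where "F \<subseteq> B" "G \<subseteq> B" "F \<inter> G = {}" "uncountable F" "uncountable G"
        "\<And>A. A \<in> fam f B \<Longrightarrow> countable (A \<inter> F)" "\<And>A. A \<in> fam f B \<Longrightarrow> countable (A \<inter> G)"
        using almost_disjoint_extension_pair[of "fam f B" B] conjunct2[OF True] by metis
      then show ?thesis
        unfolding P_def by (intro exI[of _ "(F, G)"]) auto
    next
      case False
      then show ?thesis
        unfolding P_def by (intro exI[of _ "({}, {})"]) auto
    qed
  qed
  then obtain f where f: "\<And>B. B \<in> Pow I \<Longrightarrow> P f B (f B)"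
    by blast
  define p q where "p B = fst (f B)" and "q B = snd (f B)" for B
  have pq: "p B \<subseteq> B" "q B \<subseteq> B" "p B \<inter> q B = {}"
      "\<And>A. A \<in> fam f B \<Longrightarrow> countable (A \<inter> p B)" "\<And>A. A \<in> fam f B \<Longrightarrow> countable (A \<inter> q B)"
      "B \<in> sigma_ideal (fam f B) \<or> uncountable (p B) \<and> uncountable (q B)" if "B \<in> Pow I" for B
    using f[OF that, unfolded P_def, rule_format, OF that] unfolding p_def q_def by (elim conjE; simp)+
  have fam_D: "D x \<in> fam f B" if "x \<in> I" for x B
    unfolding fam_def using that by blast
  have fam_pq: "p C \<in> fam f B" "q C \<in> fam f B" if "C \<in> underS r B" for B C
    unfolding fam_def p_def q_def using that by auto
  have total: "B \<in> underS r C \<or> C \<in> underS r B" if "B \<in> Pow I" "C \<in> Pow I" "B \<noteq> C" for B C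
    using r that
    unfolding card_order_on_def well_order_on_def linear_order_on_def total_on_def underS_def
    by auto
  \<comment> \<open>A small stage may return countable sets, which the filter discards.\<close>
  define \<A> where "\<A> = {A \<in> D ` I \<union> p ` Pow I. uncountable A}"
  define \<B> where "\<B> = {A \<in> q ` Pow I. uncountable A}"
  have fam_sub: "A \<in> \<A> \<or> A \<in> \<B> \<or> countable A" if "A \<in> fam f B" "B \<in> Pow I" for A B
  proof -
    have U: "C \<in> Pow I" if "C \<in> underS r B" for C
      using underS_Field[OF that] unfolding r(2) .
    have "A \<in> D ` I \<union> p ` underS r B \<union> q ` underS r B"
      using that(1) unfolding fam_def p_def q_def comp_def .
    then consider x where "x \<in> I" "A = D x" | C where "C \<in> underS r B" "A = p C" | C where "C \<in> underS r B" "A = q C"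
      by (elim UnE imageE)
    then show ?thesis
    proof cases
      case 1
      then show ?thesis
        unfolding \<A>_def by simp
    next
      case 2
      then have "A \<in> p ` Pow I"
        using U by (intro image_eqI)
      then show ?thesis
        unfolding \<A>_def by simp
    next
      case 3
      then have "A \<in> q ` Pow I"
        using U by (intro image_eqI)
      then show ?thesis
        unfolding \<B>_def by simp
    qed
  qed
  have ad_Dp: "countable (D x \<inter> p B)" "countable (D x \<inter> q B)" if "x \<in> I" "B \<in> Pow I" for x B
    using pq(4,5)[OF that(2) fam_D[OF that(1)]] .
  have ad_pq: "countable (p B \<inter> p C)" "countable (q B \<inter> q C)" "countable (p B \<inter> q C)"
    if BC: "B \<in> Pow I" "C \<in> Pow I" "B \<noteq> C" for B C
  proof -
    have "countable (p B \<inter> p C) \<and> countable (q B \<inter> q C) \<and> countable (p B \<inter> q C)"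
      using total[OF BC]
    proof
      assume "B \<in> underS r C"
      then show ?thesis
        using pq(4,5)[OF BC(2)] fam_pq[of B C] by simp
    next
      assume "C \<in> underS r B"
      then show ?thesis
        using pq(4,5)[OF BC(1)] fam_pq[of C B] by (simp add: Int_commute[of "p B"] Int_commute[of "q B"])
    qed
    then show "countable (p B \<inter> p C)" "countable (q B \<inter> q C)" "countable (p B \<inter> q C)"
      by simp_all
  qed
  \<comment> \<open>For equal stages the disjointness of \<open>p B\<close> and \<open>q B\<close>
    takes over.\<close>
  have ad_cross: "countable (p B \<inter> q C)" if "B \<in> Pow I" "C \<in> Pow I" for B C
    using ad_pq(3)[of B C] pq(3)[of B] that by (cases "B = C") auto
  have adA: "countable (A \<inter> A')" if A: "A \<in> \<A>" "A' \<in> \<A>" "A \<noteq> A'" for A A'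
  proof -
    have "A \<in> D ` I \<union> p ` Pow I" "A' \<in> D ` I \<union> p ` Pow I"
      using A(1,2) unfolding \<A>_def by simp_all
    then show ?thesis
    proof (elim UnE imageE)
      fix x y assume "x \<in> I" "A = D x" "y \<in> I" "A' = D y"
      then show ?thesis
        using A(3) D_disj[of x y] by (cases "x = y") auto
    next
      fix x B assume "x \<in> I" "A = D x" "B \<in> Pow I" "A' = p B"
      then show ?thesis
        using ad_Dp(1)[of x B] by simp
    next
      fix x B assume "x \<in> I" "A' = D x" "B \<in> Pow I" "A = p B"
      then show ?thesis
        using ad_Dp(1)[of x B] by (simp add: Int_commute)
    next
      fix B C assume "B \<in> Pow I" "A = p B" "C \<in> Pow I" "A' = p C"
      then show ?thesis
        using A(3) ad_pq(1)[of B C] by (cases "B = C") simp_all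
    qed
  qed
  have adB: "countable (A \<inter> A')" if A: "A \<in> \<B>" "A' \<in> \<B>" "A \<noteq> A'" for A A'
  proof -
    obtain B C where "B \<in> Pow I" "A = q B" "C \<in> Pow I" "A' = q C"
      using A(1,2) unfolding \<B>_def by (elim CollectE conjE imageE)
    then show ?thesis
      using A(3) ad_pq(2)[of B C] by (cases "B = C") simp_all
  qed
  have adAB: "countable (A \<inter> A')" if A: "A \<in> \<A>" "A' \<in> \<B>" for A A'
  proof -
    obtain B where B: "B \<in> Pow I" "A' = q B"
      using A(2) unfolding \<B>_def by (elim CollectE conjE imageE)
    have "A \<in> D ` I \<union> p ` Pow I"
      using A(1) unfolding \<A>_def by simp
    then show ?thesis
      using ad_Dp(2)[OF _ B(1)] ad_cross[OF _ B(1)] unfolding B(2) by (elim UnE imageE) simp_all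
  qed
  have fam_AB: "almost_disjoint_family I (\<A> \<union> \<B>)"
  proof
    have sub_I: "p C \<subseteq> I" "q C \<subseteq> I" if "C \<in> Pow I" for C
      using pq(1,2)[OF that] PowD[OF that] by (metis order_trans)+
    show "A \<subseteq> I" "uncountable A" if A: "A \<in> \<A> \<union> \<B>" for A
    proof -
      have "A \<in> D ` I \<union> p ` Pow I \<union> q ` Pow I"
        using A unfolding \<A>_def \<B>_def by (elim UnE) simp_all
      then show "A \<subseteq> I"
        using sub_I D(2) by (elim UnE imageE) simp_all
      show "uncountable A"
        using A unfolding \<A>_def \<B>_def by (elim UnE) simp_all
    qed
    show "countable (A \<inter> B)" if "A \<in> \<A> \<union> \<B>" "B \<in> \<A> \<union> \<B>" "A \<noteq> B" for A B
      using that(1,2)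
    proof (elim UnE)
      assume "A \<in> \<B>" "B \<in> \<A>"
      then show ?thesis
        using adAB[of B A] by (simp add: Int_commute)
    qed (use that(3) adA adB adAB in simp_all)
  qed
  have disj: "\<A> \<inter> \<B> = {}"
  proof (rule equals0I)
    fix A assume "A \<in> \<A> \<inter> \<B>"
    then show False
      using adAB[of A A] unfolding \<B>_def by simp
  qed
  \<comment> \<open>A countable \<open>\<C>\<close> misses some \<open>D x\<close>, which is almost
    disjoint from every member of \<open>\<C>\<close>. If \<open>\<C>\<close> covered
    \<open>I\<close> up to a countable set, \<open>D x\<close> would be countable.\<close>
  have I_pos: "I \<notin> sigma_ideal (\<A> \<union> \<B>)"
  proof
    assume "I \<in> sigma_ideal (\<A> \<union> \<B>)"
    then obtain \<C> where C: "\<C> \<subseteq> \<A> \<union> \<B>" "countable \<C>" "countable (I - \<Union>\<C>)"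
      by (rule sigma_idealE)
    have "inj_on D I"
      using D_disj D(3) by (intro inj_onI) (metis Int_absorb countable_empty)
    then have "uncountable (D ` I)"
      using I countable_image_inj_on by blast
    then have "\<not> D ` I \<subseteq> \<C>"
      using C(2) by (metis countable_subset)
    then obtain x where x: "x \<in> I" "D x \<notin> \<C>"
      by blast
    have "I \<in> sigma_ideal \<C>"
      using C(2,3) by (intro sigma_idealI[OF order_refl])
    then have "D x \<in> sigma_ideal \<C>"
      by (rule sigma_ideal_subset) (rule D(2)[OF x(1)])
    moreover have "D x \<in> \<A>"
      using x D(3) unfolding \<A>_def by simp
    then have "countable (A \<inter> D x)" if "A \<in> \<C>" for A
      using that C(1) x(2) almost_disjoint_family.ad[OF fam_AB, of A "D x"] by blast
    ultimately have "countable (D x)"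
      by (rule sigma_ideal_countable)
    then show False
      using D(3) x(1) by blast
  qed
  \<comment> \<open>If \<open>S\<close> is small at its own stage, it is almost covered by earlier
    sets; were all members of \<open>\<B>\<close> to meet \<open>S\<close> in countable sets, those
    among the earlier sets could be dropped and \<open>S\<close> would lie in the ideal of
    \<open>\<A>\<close>. Otherwise \<open>q S\<close> was chosen as an uncountable subset of
    \<open>S\<close>.\<close>
  have pos_A: "\<exists>B\<in>\<B>. uncountable (B \<inter> S)" if S: "S \<subseteq> I" "S \<notin> sigma_ideal \<A>" for S
  proof (cases "S \<in> sigma_ideal (fam f S)")
    case True
    show ?thesis
    proof (rule ccontr)
      assume "\<not> ?thesis"
      then have "S \<in> sigma_ideal \<A>"
        using fam_sub[OF _ PowI[OF S(1)]] by (intro sigma_ideal_change[OF True]) (metis countable_Int1)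
      then show False
        using S(2) by blast
    qed
  next
    case False
    then have "q S \<in> \<B>" "q S \<inter> S = q S"
      using pq(2)[of S] pq(6)[of S] S(1) unfolding \<B>_def by auto
    then show ?thesis
      unfolding \<B>_def by (intro bexI[of _ "q S"]) simp_all
  qed
  have pos_B: "\<exists>A\<in>\<A>. uncountable (A \<inter> S)" if S: "S \<subseteq> I" "S \<notin> sigma_ideal \<B>" for S
  proof (cases "S \<in> sigma_ideal (fam f S)")
    case True
    show ?thesis
    proof (rule ccontr)
      assume "\<not> ?thesis"
      then have "S \<in> sigma_ideal \<B>"
        using fam_sub[OF _ PowI[OF S(1)]] by (intro sigma_ideal_change[OF True]) (metis countable_Int1)
      then show False
        using S(2) by blast
    qed
  next
    case False
    then have "p S \<in> \<A>" "p S \<inter> S = p S"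
      using pq(1)[of S] pq(6)[of S] S(1) unfolding \<A>_def by auto
    then show ?thesis
      unfolding \<A>_def by (intro bexI[of _ "p S"]) simp_all
  qed
  show thesis
  proof (rule that[folded I_def])
    show "\<exists>B\<in>\<B>. uncountable (B \<inter> S)" if "S \<subseteq> I" "S \<notin> sigma_ideal \<A>" for S
      using that by (rule pos_A)
    show "\<exists>A\<in>\<A>. uncountable (A \<inter> S)" if "S \<subseteq> I" "S \<notin> sigma_ideal \<B>" for S
      using that by (rule pos_B)
  qed (fact fam_AB disj I_pos)+
qed

section \<open>The one-point Lindelof extension of a Mrowka space\<close>

text \<open>The isolated points are the singletons \<open>{i}\<close>, the members of \<open>\<A>\<close> are themselves points, and
  \<open>{}\<close> is the point at infinity.\<close>

definition mrowka_open :: "'a set \<Rightarrow> 'a set set \<Rightarrow> 'a set set \<Rightarrow> bool" where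
  "mrowka_open I \<A> U \<longleftrightarrow> U \<subseteq> insert {} (\<A> \<union> (\<lambda>i. {i}) ` I) \<and>
    (\<forall>A\<in>\<A> \<inter> U. countable {i \<in> A. {i} \<notin> U}) \<and>
    ({} \<in> U \<longrightarrow> countable (\<A> - U) \<and> {i \<in> I. {i} \<notin> U} \<in> sigma_ideal \<A>)"

definition mrowka :: "'a set \<Rightarrow> 'a set set \<Rightarrow> 'a set topology" where
  "mrowka I \<A> = topology (mrowka_open I \<A>)"

lemma mrowka_openI:
  assumes "U \<subseteq> insert {} (\<A> \<union> (\<lambda>i. {i}) ` I)"
    and "\<And>A. A \<in> \<A> \<Longrightarrow> A \<in> U \<Longrightarrow> countable {i \<in> A. {i} \<notin> U}"
    and "{} \<in> U \<Longrightarrow> countable (\<A> - U)"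
    and "{} \<in> U \<Longrightarrow> {i \<in> I. {i} \<notin> U} \<in> sigma_ideal \<A>"
  shows "mrowka_open I \<A> U"
  using assms unfolding mrowka_open_def by simp

lemma mrowka_openD:
  assumes "mrowka_open I \<A> U"
  shows "U \<subseteq> insert {} (\<A> \<union> (\<lambda>i. {i}) ` I)"
    and "A \<in> \<A> \<Longrightarrow> A \<in> U \<Longrightarrow> countable {i \<in> A. {i} \<notin> U}"
    and "{} \<in> U \<Longrightarrow> countable (\<A> - U)"
    and "{} \<in> U \<Longrightarrow> {i \<in> I. {i} \<notin> U} \<in> sigma_ideal \<A>"
  using assms unfolding mrowka_open_def by simp_all

lemma istopology_mrowka_open: "istopology (mrowka_open I \<A>)"
  unfolding istopology_def
proof (intro conjI allI impI)
  fix S T assume S: "mrowka_open I \<A> S" and T: "mrowka_open I \<A> T"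
  have split: "{i \<in> J. {i} \<notin> S \<inter> T} = {i \<in> J. {i} \<notin> S} \<union> {i \<in> J. {i} \<notin> T}" for J
    by auto
  show "mrowka_open I \<A> (S \<inter> T)"
  proof (rule mrowka_openI)
    show "S \<inter> T \<subseteq> insert {} (\<A> \<union> (\<lambda>i. {i}) ` I)"
      using mrowka_openD(1)[OF S] by (rule le_infI1)
    show "countable {i \<in> A. {i} \<notin> S \<inter> T}" if "A \<in> \<A>" "A \<in> S \<inter> T" for A
      unfolding split using mrowka_openD(2)[OF S] mrowka_openD(2)[OF T] that by simp
    show "countable (\<A> - S \<inter> T)" if "{} \<in> S \<inter> T"
      unfolding Diff_Int using mrowka_openD(3)[OF S] mrowka_openD(3)[OF T] that by simp
    show "{i \<in> I. {i} \<notin> S \<inter> T} \<in> sigma_ideal \<A>" if "{} \<in> S \<inter> T"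
      unfolding split using mrowka_openD(4)[OF S] mrowka_openD(4)[OF T] that
      by (intro sigma_ideal_Un) simp_all
  qed
next
  fix \<K> assume K: "\<forall>S\<in>\<K>. mrowka_open I \<A> S"
  have sub: "{i \<in> J. {i} \<notin> \<Union>\<K>} \<subseteq> {i \<in> J. {i} \<notin> S}" if "S \<in> \<K>" for J S
    using that by auto
  show "mrowka_open I \<A> (\<Union>\<K>)"
  proof (rule mrowka_openI)
    show "\<Union>\<K> \<subseteq> insert {} (\<A> \<union> (\<lambda>i. {i}) ` I)"
      using K by (intro Union_least) (rule mrowka_openD(1), simp)
    show "countable {i \<in> A. {i} \<notin> \<Union>\<K>}" if "A \<in> \<A>" "A \<in> \<Union>\<K>" for A
    proof -
      obtain S where S: "S \<in> \<K>" "A \<in> S"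
        using \<open>A \<in> \<Union>\<K>\<close> by (rule UnionE)
      show ?thesis
        by (rule countable_subset[OF sub[OF S(1)]], rule mrowka_openD(2)[OF K[rule_format, OF S(1)] that(1) S(2)])
    qed
    assume "{} \<in> \<Union>\<K>"
    then obtain S where S: "S \<in> \<K>" "{} \<in> S"
      by (rule UnionE)
    note D = mrowka_openD[OF K[rule_format, OF S(1)]]
    have "\<A> - \<Union>\<K> \<subseteq> \<A> - S"
      using S(1) by auto
    then show "countable (\<A> - \<Union>\<K>)"
      using D(3)[OF S(2)] by (rule countable_subset)
    show "{i \<in> I. {i} \<notin> \<Union>\<K>} \<in> sigma_ideal \<A>"
      using D(4)[OF S(2)] sub[OF S(1)] by (rule sigma_ideal_subset)
  qed
qed

lemma openin_mrowka: "openin (mrowka I \<A>) = mrowka_open I \<A>"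
  unfolding mrowka_def by (rule topology_inverse') (rule istopology_mrowka_open)

lemmas openin_mrowkaI = mrowka_openI[folded openin_mrowka]
lemmas openin_mrowkaD = mrowka_openD[folded openin_mrowka]

text \<open>The openness assumption makes \<open>insert x F\<close> closed, so \<open>x\<close> is
  the only possible new limit; the last assumption makes it one.\<close>

lemma almost_closed_toI:
  assumes "F \<subseteq> topspace X" "x \<in> topspace X" "x \<notin> F" "openin X (topspace X - insert x F)"
    "\<And>U. openin X U \<Longrightarrow> x \<in> U \<Longrightarrow> U \<inter> F \<noteq> {}"
  shows "almost_closed_to X F x"
proof -
  have "closedin X (insert x F)"
    using assms(1,2,4) unfolding closedin_def by blast
  then have "X closure_of F \<subseteq> insert x F"
    by (intro closure_of_minimal) auto
  moreover have "x \<in> X closure_of F"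
    using assms(2,5) unfolding in_closure_of by blast
  ultimately show ?thesis
    using assms(1,3) unfolding almost_closed_to_def by blast
qed

section \<open>Topological properties of the space of one almost disjoint family\<close>

context almost_disjoint_family
begin

text \<open>Uncountability of the members keeps the three kinds of points apart.\<close>

lemma singleton_notin: "{i} \<notin> \<A>" and empty_notin: "{} \<notin> \<A>"
  using unc by fastforce+

lemma topspace_mrowka: "topspace (mrowka I \<A>) = insert {} (\<A> \<union> (\<lambda>i. {i}) ` I)" (is "_ = ?P")
proof (rule antisym)
  show "topspace (mrowka I \<A>) \<subseteq> ?P"
    by (rule openin_mrowkaD(1)[OF openin_topspace])
  have eq: "{i \<in> A. {i} \<notin> ?P} = {}" if "A \<subseteq> I" for A
    using that by auto
  have "openin (mrowka I \<A>) ?P"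
  proof (rule openin_mrowkaI)
    show "countable {i \<in> A. {i} \<notin> ?P}" if "A \<in> \<A>" for A
      unfolding eq[OF sub[OF that]] by simp
    have "\<A> - ?P = {}"
      by auto
    then show "countable (\<A> - ?P)"
      by (simp only: countable_empty)
    show "{i \<in> I. {i} \<notin> ?P} \<in> sigma_ideal \<A>"
      unfolding eq[OF order_refl] by (rule countable_in_sigma_ideal) simp
  qed simp
  then show "?P \<subseteq> topspace (mrowka I \<A>)"
    by (rule openin_subset)
qed

lemma openin_singletons:
  assumes "S \<subseteq> I"
  shows "openin (mrowka I \<A>) ((\<lambda>i. {i}) ` S)"
  using assms singleton_notin by (intro openin_mrowkaI) auto

lemma openin_insert_member:
  assumes "A \<in> \<A>" "S \<subseteq> I" "countable (A - S)"
  shows "openin (mrowka I \<A>) (insert A ((\<lambda>i. {i}) ` S))" (is "openin _ ?U")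
proof (rule openin_mrowkaI)
  show "?U \<subseteq> insert {} (\<A> \<union> (\<lambda>i. {i}) ` I)"
    using assms by auto
  have "{} \<notin> ?U"
    using assms(1) empty_notin by auto
  then show "countable (\<A> - ?U)" "{i \<in> I. {i} \<notin> ?U} \<in> sigma_ideal \<A>" if "{} \<in> ?U"
    using that by simp_all
  have eq: "{i \<in> A. {i} \<notin> ?U} = A - S"
    using assms(1) singleton_notin by auto
  show "countable {i \<in> B. {i} \<notin> ?U}" if B: "B \<in> \<A>" "B \<in> ?U" for B
  proof -
    have "B = A"
      using B singleton_notin by auto
    then show ?thesis
      using assms(3) eq by simp
  qed
qed

text \<open>A member that stays in the set must keep all but countably many of its isolated points,
  hence the condition on its trace on \<open>S\<close>.\<close>

lemma openin_infinity:
  assumes "countable \<C>" "S \<in> sigma_ideal \<A>" "\<And>A. A \<in> \<A> \<Longrightarrow> A \<notin> \<C> \<Longrightarrow> countable (A \<inter> S)"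
  shows "openin (mrowka I \<A>) (insert {} ((\<A> - \<C>) \<union> (\<lambda>i. {i}) ` (I - S)))"
    (is "openin _ ?U")
proof (rule openin_mrowkaI)
  have eq: "{i \<in> A. {i} \<notin> ?U} = A \<inter> S" if "A \<subseteq> I" for A
    using that singleton_notin by auto
  show "?U \<subseteq> insert {} (\<A> \<union> (\<lambda>i. {i}) ` I)"
    by auto
  show "countable {i \<in> A. {i} \<notin> ?U}" if A: "A \<in> \<A>" "A \<in> ?U" for A
  proof -
    have "A \<notin> \<C>"
      using A empty_notin singleton_notin by auto
    then show ?thesis
      unfolding eq[OF sub[OF A(1)]] by (rule assms(3)[OF A(1)])
  qed
  have "\<A> - ?U \<subseteq> \<C>"
    by auto
  then show "countable (\<A> - ?U)"
    using assms(1) by (rule countable_subset)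
  show "{i \<in> I. {i} \<notin> ?U} \<in> sigma_ideal \<A>"
    unfolding eq[OF order_refl] using assms(2) by (rule sigma_ideal_subset) simp
qed

text \<open>Removing only \<open>S\<close> could spoil openness at members with uncountable trace on
  \<open>S\<close>. A countable \<open>\<D>\<close> covering \<open>S\<close> up to a countable set
  is therefore removed too, as points and with its union, and likewise for \<open>\<C>\<close>;
  every other member then loses only countably many isolated points.\<close>

lemma openin_infinity_avoiding:
  assumes "countable \<C>" "\<C> \<subseteq> \<A>" "S \<in> sigma_ideal \<A>"
  obtains U where "openin (mrowka I \<A>) U" "{} \<in> U" "U \<inter> \<C> = {}" "\<And>i. i \<in> S \<Longrightarrow> {i} \<notin> U"
proof -
  obtain \<D> where D: "\<D> \<subseteq> \<A>" "countable \<D>" "countable (S - \<Union>\<D>)"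
    using assms(3) by (rule sigma_idealE)
  define T where "T = S \<union> \<Union>(\<C> \<union> \<D>)"
  have CD: "countable (\<C> \<union> \<D>)"
    using assms(1) D(2) by simp
  have T: "T \<in> sigma_ideal \<A>"
  proof (rule sigma_idealI[OF _ CD])
    have "T - \<Union>(\<C> \<union> \<D>) \<subseteq> S - \<Union>\<D>"
      unfolding T_def by auto
    then show "countable (T - \<Union>(\<C> \<union> \<D>))"
      using D(3) by (rule countable_subset)
  qed (use assms(2) D(1) in simp)
  have "countable (A \<inter> T)" if A: "A \<in> \<A>" "A \<notin> \<C> \<union> \<D>" for A
  proof -
    have "countable (A \<inter> B)" if "B \<in> \<C> \<union> \<D>" for B
      using ad[OF A(1), of B] that A(2) assms(2) D(1) by auto
    then have "countable (\<Union>B\<in>\<C> \<union> \<D>. A \<inter> B)"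
      using CD by (intro countable_UN)
    moreover have "A \<inter> T \<subseteq> (S - \<Union>\<D>) \<union> (\<Union>B\<in>\<C> \<union> \<D>. A \<inter> B)"
      by (auto simp: T_def)
    ultimately show ?thesis
      using D(3) by (metis countable_Un countable_subset)
  qed
  from openin_infinity[OF CD T this] show thesis
    using assms(2) empty_notin singleton_notin by (intro that) (auto simp: T_def)
qed

text \<open>The proof distinguishes the kinds of the two points. Members \<open>A\<close> and
  \<open>B\<close> are separated using the traces \<open>A\<close> and \<open>B - A\<close>, which
  costs \<open>B\<close> only the countable set \<open>A \<inter> B\<close>; infinity is handled by
  \<open>openin_infinity_avoiding\<close>.\<close>

lemma Hausdorff_mrowka: "Hausdorff_space (mrowka I \<A>)"
proof -
  let ?X = "mrowka I \<A>"
  define sep where "sep x y \<longleftrightarrow> (\<exists>U V. openin ?X U \<and> openin ?X V \<and> x \<in> U \<and> y \<in> V \<and> disjnt U V)" for x y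
  have sep_sym: "sep y x" if "sep x y" for x y
    using that unfolding sep_def by (metis disjnt_sym)
  have ss: "sep {i} {j}" if "i \<in> I" "j \<in> I" "i \<noteq> j" for i j
    using that openin_singletons[of "{i}"] openin_singletons[of "{j}"]
    unfolding sep_def by (intro exI[of _ "{{i}}"] exI[of _ "{{j}}"]) auto
  have sA: "sep {i} A" if "i \<in> I" "A \<in> \<A>" for i A
  proof -
    have "countable (A - (A - {i}))"
      by (rule countable_subset[of _ "{i}"]) auto
    then have "openin ?X (insert A ((\<lambda>i. {i}) ` (A - {i})))"
      using that sub by (intro openin_insert_member) auto
    then show ?thesis
      using that openin_singletons[of "{i}"] singleton_notin
      unfolding sep_def
      by (intro exI[of _ "{{i}}"] exI[of _ "insert A ((\<lambda>i. {i}) ` (A - {i}))"]) (auto simp: disjnt_def)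
  qed
  have AB: "sep A B" if "A \<in> \<A>" "B \<in> \<A>" "A \<noteq> B" for A B
  proof -
    have "B - (B - A) = A \<inter> B"
      by auto
    then have "openin ?X (insert B ((\<lambda>i. {i}) ` (B - A)))"
      using that sub ad by (intro openin_insert_member) auto
    moreover have "openin ?X (insert A ((\<lambda>i. {i}) ` A))"
      using that sub by (intro openin_insert_member) auto
    ultimately show ?thesis
      using that singleton_notin unfolding sep_def
      by (intro exI[of _ "insert A ((\<lambda>i. {i}) ` A)"] exI[of _ "insert B ((\<lambda>i. {i}) ` (B - A))"])
         (auto simp: disjnt_def)
  qed
  have si: "sep {i} {}" if i: "i \<in> I" for i
  proof -
    obtain U where "openin ?X U" "{} \<in> U" "{i} \<notin> U"
      by (rule openin_infinity_avoiding[OF _ _ countable_in_sigma_ideal, of "{}" "{i}"]) auto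
    then show ?thesis
      using openin_singletons[of "{i}"] i unfolding sep_def
      by (intro exI[of _ "{{i}}"] exI[of _ U]) (auto simp: disjnt_def)
  qed
  have Ai: "sep A {}" if A: "A \<in> \<A>" for A
  proof -
    obtain U where "openin ?X U" "{} \<in> U" "U \<inter> {A} = {}" "\<And>i. i \<in> A \<Longrightarrow> {i} \<notin> U"
      by (rule openin_infinity_avoiding[OF _ _ member_in_sigma_ideal[OF A], of "{A}"]) (use A in auto)
    moreover have "openin ?X (insert A ((\<lambda>i. {i}) ` A))"
      using A sub by (intro openin_insert_member) auto
    ultimately show ?thesis
      unfolding sep_def
      by (intro exI[of _ "insert A ((\<lambda>i. {i}) ` A)"] exI[of _ U]) (auto simp: disjnt_def)
  qed
  have "sep x y" if "x \<in> topspace ?X" "y \<in> topspace ?X" "x \<noteq> y" for x y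
    using that unfolding topspace_mrowka
    by (elim insertE UnE imageE)
       (simp_all add: ss sA AB si Ai sep_sym[OF sA] sep_sym[OF si] sep_sym[OF Ai])
  then show ?thesis
    unfolding Hausdorff_space_def sep_def by simp
qed

text \<open>A neighbourhood of infinity misses only countably many members and a small set of
  isolated points. Neighbourhoods of countably many members absorb that set up to countably many
  points, which are covered one by one.\<close>

lemma Lindelof_mrowka: "Lindelof_space (mrowka I \<A>)"
  unfolding Lindelof_space_def
proof (intro allI impI)
  let ?X = "mrowka I \<A>"
  fix \<U> assume U: "(\<forall>U\<in>\<U>. openin ?X U) \<and> \<Union>\<U> = topspace ?X"
  define N where "N x = (SOME U. U \<in> \<U> \<and> x \<in> U)" for x
  have N: "N x \<in> \<U> \<and> x \<in> N x" if "x \<in> topspace ?X" for x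
  proof -
    have "x \<in> \<Union>\<U>"
      using that conjunct2[OF U] by simp
    then have "\<exists>U. U \<in> \<U> \<and> x \<in> U"
      by auto
    then show ?thesis
      unfolding N_def by (rule someI_ex)
  qed
  have N_open: "openin ?X (N x)" if "x \<in> topspace ?X" for x
    using N[OF that] conjunct1[OF U] by simp
  have inf: "{} \<in> topspace ?X"
    unfolding topspace_mrowka by blast
  note tr = openin_mrowkaD(3,4)[OF N_open[OF inf] conjunct2[OF N[OF inf]]]
  obtain \<C> where C: "\<C> \<subseteq> \<A>" "countable \<C>" "countable ({i \<in> I. {i} \<notin> N {}} - \<Union>\<C>)"
    using tr(2) by (rule sigma_idealE)
  \<comment> \<open>\<open>\<D>\<close> joins the members that almost cover the missed isolated
    points with the members that are missed themselves.\<close>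
  define \<D> where "\<D> = \<C> \<union> (\<A> - N {})"
  have D: "countable \<D>" "\<D> \<subseteq> \<A>"
    using C tr(1) unfolding \<D>_def by auto
  \<comment> \<open>\<open>J\<close> collects the isolated points that may still be
    uncovered.\<close>
  define J where "J = ({i \<in> I. {i} \<notin> N {}} - \<Union>\<C>) \<union> (\<Union>A\<in>\<D>. {i \<in> A. {i} \<notin> N A})"
  have "countable {i \<in> A. {i} \<notin> N A}" if "A \<in> \<D>" for A
  proof -
    have "A \<in> \<A>" "A \<in> topspace ?X"
      using that D unfolding topspace_mrowka by auto
    then show ?thesis
      using openin_mrowkaD(2)[OF N_open] N by simp
  qed
  then have J: "countable J"
    using D(1) C(3) unfolding J_def by (intro countable_Un countable_UN)
  have JI: "J \<subseteq> I"
    using D(2) sub unfolding J_def by auto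
  define \<V> where "\<V> = N ` (insert {} (\<D> \<union> (\<lambda>i. {i}) ` J))"
  have sub_top: "insert {} (\<D> \<union> (\<lambda>i. {i}) ` J) \<subseteq> topspace ?X"
    using D(2) JI unfolding topspace_mrowka by auto
  have "countable \<V>"
    using D(1) J unfolding \<V>_def by simp
  moreover have VU: "\<V> \<subseteq> \<U>"
    using N[OF subsetD[OF sub_top]] unfolding \<V>_def by (intro image_subsetI) simp
  moreover have "x \<in> \<Union>\<V>" if x: "x \<in> topspace ?X" for x
  proof -
    have Nx: "x \<in> \<Union>\<V>" if "y \<in> insert {} (\<D> \<union> (\<lambda>i. {i}) ` J)" "x \<in> N y" for y
      unfolding \<V>_def using that by (rule UN_I)
    consider "x = {}" | "x \<in> \<A>" | i where "i \<in> I" "x = {i}"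
      using x unfolding topspace_mrowka by auto
    then show ?thesis
    proof cases
      case 1
      then show ?thesis
        using Nx[of "{}"] N[OF inf] by simp
    next
      case 2
      then show ?thesis
        using Nx[of x] Nx[of "{}"] N[OF x] unfolding \<D>_def by auto
    next
      case 3
      then consider "x \<in> N {}" | "i \<in> J" | A where "A \<in> \<D>" "x \<in> N A"
        unfolding J_def \<D>_def by auto
      then show ?thesis
      proof cases
        case 1
        then show ?thesis
          by (rule Nx[rotated]) simp
      next
        case 2
        then show ?thesis
          using 3 N[OF x] by (intro Nx[of x]) simp_all
      next
        case (3 A)
        then show ?thesis
          by (intro Nx[of A]) simp_all
      qed
    qed
  qed
  then have "topspace ?X \<subseteq> \<Union>\<V>"
    by (rule subsetI)
  moreover have "\<Union>\<V> \<subseteq> topspace ?X"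
    using Union_mono[OF VU] conjunct2[OF U] by simp
  ultimately show "\<exists>\<V>. countable \<V> \<and> \<V> \<subseteq> \<U> \<and> \<Union>\<V> = topspace ?X"
    by (intro exI[of _ \<V>] conjI equalityI)
qed

text \<open>Openness restricts the omitted points to \<sigma>-ideals, and what a countable
  intersection omits is the union of what its terms omit.\<close>

lemma P_space_mrowka: "P_space (mrowka I \<A>)"
  unfolding P_space_def
proof (intro allI impI)
  let ?X = "mrowka I \<A>"
  fix G assume "gdelta_in ?X G"
  then obtain \<K> where K: "countable \<K>" "\<And>U. U \<in> \<K> \<Longrightarrow> openin ?X U" "\<Inter>\<K> = G" and G: "G \<subseteq> topspace ?X"
    unfolding gdelta_in_alt intersection_of_def by (metis Ball_Collect)
  show "openin ?X G"
  proof (rule openin_mrowkaI)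
    show "G \<subseteq> insert {} (\<A> \<union> (\<lambda>i. {i}) ` I)"
      using G unfolding topspace_mrowka .
    show "countable {i \<in> A. {i} \<notin> G}" if "A \<in> \<A>" "A \<in> G" for A
    proof -
      have "countable {i \<in> A. {i} \<notin> U}" if "U \<in> \<K>" for U
        by (rule openin_mrowkaD(2)[OF K(2)[OF that]]) (use \<open>A \<in> \<A>\<close> \<open>A \<in> G\<close> K(3) that in auto)
      then have "countable (\<Union>U\<in>\<K>. {i \<in> A. {i} \<notin> U})"
        using K(1) by (intro countable_UN)
      then show ?thesis
        by (rule countable_subset[rotated]) (use K(3) in auto)
    qed
    show "countable (\<A> - G)" "{i \<in> I. {i} \<notin> G} \<in> sigma_ideal \<A>" if "{} \<in> G"
    proof -
      have inf: "{} \<in> U" if "U \<in> \<K>" for U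
        using \<open>{} \<in> G\<close> K(3) that by blast
      have "countable (\<Union>U\<in>\<K>. \<A> - U)"
        using K(1) openin_mrowkaD(3)[OF K(2) inf] by (intro countable_UN)
      then show "countable (\<A> - G)"
        by (rule countable_subset[rotated]) (use K(3) in auto)
      have "(\<Union>U\<in>\<K>. {i \<in> I. {i} \<notin> U}) \<in> sigma_ideal \<A>"
        using K(1) openin_mrowkaD(4)[OF K(2) inf] by (intro sigma_ideal_UN)
      then show "{i \<in> I. {i} \<notin> G} \<in> sigma_ideal \<A>"
        by (rule sigma_ideal_subset) (use K(3) in auto)
    qed
  qed
qed

text \<open>Countable traces prevent \<open>S\<close> from accumulating at any member. If a
  neighbourhood of infinity missed \<open>S\<close>, then \<open>S\<close> would be small and hence
  countable.\<close>

lemma almost_closed_to_infinity: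
  assumes "S \<subseteq> I" "uncountable S" "\<And>A. A \<in> \<A> \<Longrightarrow> countable (A \<inter> S)"
  shows "almost_closed_to (mrowka I \<A>) ((\<lambda>i. {i}) ` S) {}"
proof (rule almost_closed_toI)
  let ?X = "mrowka I \<A>"
  let ?W = "topspace ?X - insert {} ((\<lambda>i. {i}) ` S)"
  show "openin ?X ?W"
  proof (rule openin_mrowkaI)
    have "{i \<in> A. {i} \<notin> ?W} = A \<inter> S" if "A \<in> \<A>" for A
      using sub[OF that] unfolding topspace_mrowka by auto
    then show "countable {i \<in> A. {i} \<notin> ?W}" if "A \<in> \<A>" for A
      using that assms(3) by simp
  qed (auto simp: topspace_mrowka)
  show "U \<inter> (\<lambda>i. {i}) ` S \<noteq> {}" if "openin ?X U" "{} \<in> U" for U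
  proof
    assume "U \<inter> (\<lambda>i. {i}) ` S = {}"
    then have "S \<subseteq> {i \<in> I. {i} \<notin> U}"
      using assms(1) by blast
    then have "S \<in> sigma_ideal \<A>"
      using openin_mrowkaD(4)[OF that] by (metis sigma_ideal_subset)
    then show False
      using assms(2,3) by (metis sigma_ideal_countable)
  qed
qed (use assms(1) in \<open>auto simp: topspace_mrowka\<close>)

text \<open>At a member, the trace of the given set on it converges to it. At infinity, either
  uncountably many members lie in the set, and these converge by themselves, or its isolated points
  form a set outside the ideal, to which \<open>mad\<close> applies.\<close>

lemma Whyburn_mrowka:
  assumes mad: "\<And>S. S \<subseteq> I \<Longrightarrow> S \<notin> sigma_ideal \<A> \<Longrightarrow>
    \<exists>F\<subseteq>S. uncountable F \<and> (\<forall>A\<in>\<A>. countable (A \<inter> F))"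
  shows "Whyburn_space (mrowka I \<A>)"
  unfolding Whyburn_space_def
proof (intro allI impI ballI)
  let ?X = "mrowka I \<A>"
  fix E x assume "E \<subseteq> topspace ?X \<and> \<not> closedin ?X E" and x: "x \<in> (?X closure_of E) - E"
  then have E: "E \<subseteq> topspace ?X"
    by blast
  define S where "S = {i \<in> I. {i} \<in> E}"
  have meets: "U \<inter> E \<noteq> {}" if "openin ?X U" "x \<in> U" for U
    using DiffD1[OF x] that unfolding in_closure_of by auto
  have "x \<in> topspace ?X"
    using DiffD1[OF x] unfolding in_closure_of by simp
  then consider i where "i \<in> I" "x = {i}" | "x \<in> \<A>" | "x = {}"
    unfolding topspace_mrowka by auto
  then show "\<exists>F\<subseteq>E. almost_closed_to ?X F x"
  proof cases
    case 1
    then show ?thesis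
      using meets[of "{{i}}"] openin_singletons[of "{i}"] x by auto
  next
    case 2
    let ?F = "(\<lambda>i. {i}) ` (x \<inter> S)"
    \<comment> \<open>Otherwise \<open>x\<close> with the isolated points of \<open>x - S\<close>
      would be a neighbourhood of \<open>x\<close> missing \<open>E\<close>.\<close>
    have unc_trace: "uncountable (x \<inter> S)"
    proof
      assume "countable (x \<inter> S)"
      moreover have "x - (x - S) = x \<inter> S"
        by auto
      ultimately have "openin ?X (insert x ((\<lambda>i. {i}) ` (x - S)))"
        using 2 sub[OF 2] by (intro openin_insert_member) auto
      then have "insert x ((\<lambda>i. {i}) ` (x - S)) \<inter> E \<noteq> {}"
        by (rule meets) auto
      then show False
        using x sub[OF 2] unfolding S_def by auto
    qed
    have "almost_closed_to ?X ?F x"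
    proof (rule almost_closed_toI)
      let ?W = "topspace ?X - insert x ?F"
      have eq: "{i \<in> A. {i} \<notin> ?W} = A \<inter> (x \<inter> S)" if "A \<subseteq> I" for A
        using that 2 singleton_notin unfolding topspace_mrowka by auto
      show "openin ?X ?W"
      proof (rule openin_mrowkaI)
        show "countable {i \<in> A. {i} \<notin> ?W}" if A: "A \<in> \<A>" "A \<in> ?W" for A
        proof -
          have "countable (A \<inter> x)"
            using A by (intro ad[OF A(1) 2]) auto
          then have "countable (A \<inter> (x \<inter> S))"
            by (rule countable_subset[rotated]) auto
          then show ?thesis
            unfolding eq[OF sub[OF A(1)]] .
        qed
        have "\<A> - ?W \<subseteq> {x}"
          using singleton_notin by (auto simp: topspace_mrowka)
        then show "countable (\<A> - ?W)"
          by (rule countable_subset) simp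
        show "{i \<in> I. {i} \<notin> ?W} \<in> sigma_ideal \<A>"
          unfolding eq[OF order_refl]
          by (rule sigma_ideal_subset[OF member_in_sigma_ideal[OF 2]]) auto
      qed (auto simp: topspace_mrowka)
      show "U \<inter> ?F \<noteq> {}" if "openin ?X U" "x \<in> U" for U
      proof
        assume "U \<inter> ?F = {}"
        then have "x \<inter> S \<subseteq> {i \<in> x. {i} \<notin> U}"
          by auto
        then show False
          using unc_trace openin_mrowkaD(2)[OF that(1) 2 that(2)] by (metis countable_subset)
      qed
    qed (use 2 singleton_notin in \<open>auto simp: topspace_mrowka S_def\<close>)
    then show ?thesis
      unfolding S_def by (intro exI[of _ ?F]) (auto simp: S_def)
  next
    case 3
    show ?thesis
    proof (cases "countable (E \<inter> \<A>)")
      case False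
      have "almost_closed_to ?X (E \<inter> \<A>) {}"
      proof (rule almost_closed_toI)
        let ?W = "topspace ?X - insert {} (E \<inter> \<A>)"
        show "openin ?X ?W"
        proof (rule openin_mrowkaI)
          have eq: "{i \<in> A. {i} \<notin> ?W} = {}" if "A \<in> \<A>" for A
            using sub[OF that] singleton_notin unfolding topspace_mrowka by auto
          show "countable {i \<in> A. {i} \<notin> ?W}" if "A \<in> \<A>" for A
            unfolding eq[OF that] by simp
        qed (auto simp: topspace_mrowka)
        show "U \<inter> (E \<inter> \<A>) \<noteq> {}" if "openin ?X U" "{} \<in> U" for U
        proof
          assume "U \<inter> (E \<inter> \<A>) = {}"
          then have "E \<inter> \<A> \<subseteq> \<A> - U"
            by auto
          then show False
            using False openin_mrowkaD(3)[OF that] by (metis countable_subset)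
        qed
      qed (use empty_notin in \<open>auto simp: topspace_mrowka\<close>)
      then show ?thesis
        unfolding 3 by (intro exI[of _ "E \<inter> \<A>"] conjI Int_lower1)
    next
      case True
      \<comment> \<open>If \<open>S\<close> were small, one neighbourhood of infinity could avoid
        both \<open>S\<close> and the countably many members in \<open>E\<close>.\<close>
      have "S \<notin> sigma_ideal \<A>"
      proof
        assume "S \<in> sigma_ideal \<A>"
        then obtain U where U: "openin ?X U" "{} \<in> U" "U \<inter> (E \<inter> \<A>) = {}" "\<And>i. i \<in> S \<Longrightarrow> {i} \<notin> U"
          using openin_infinity_avoiding[OF True Int_lower2] by metis
        moreover have "U \<inter> E \<subseteq> insert {} ((E \<inter> \<A>) \<union> (\<lambda>i. {i}) ` S)"
          using E unfolding S_def topspace_mrowka by auto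
        ultimately show False
          using meets[of U] x 3 by auto
      qed
      then obtain F where "F \<subseteq> S" "uncountable F" "\<And>A. A \<in> \<A> \<Longrightarrow> countable (A \<inter> F)"
        using mad[of S] unfolding S_def by (metis (no_types, lifting) mem_Collect_eq subsetI)
      then show ?thesis
        using almost_closed_to_infinity[of F] unfolding 3 S_def
        by (intro exI[of _ "(\<lambda>i. {i}) ` F"]) auto
    qed
  qed
qed

end

section \<open>The product\<close>

lemma in_prod_closure_ofI:
  assumes "x \<in> topspace X" "y \<in> topspace Y"
    and "\<And>U V. openin X U \<Longrightarrow> x \<in> U \<Longrightarrow> openin Y V \<Longrightarrow> y \<in> V \<Longrightarrow> F \<inter> (U \<times> V) \<noteq> {}"
  shows "(x, y) \<in> prod_topology X Y closure_of F"
  unfolding in_closure_of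
proof (intro conjI allI impI)
  show "(x, y) \<in> topspace (prod_topology X Y)"
    using assms(1,2) by simp
  fix T assume "(x, y) \<in> T \<and> openin (prod_topology X Y) T"
  then obtain U V where UV: "openin X U" "openin Y V" "x \<in> U" "y \<in> V" "U \<times> V \<subseteq> T"
    unfolding openin_prod_topology_alt by metis
  then show "\<exists>p. p \<in> F \<and> p \<in> T"
    using assms(3)[OF UV(1,3,2,4)] by auto
qed

lemma almost_disjoint_family_subset:
  assumes "almost_disjoint_family I \<B>" "\<A> \<subseteq> \<B>"
  shows "almost_disjoint_family I \<A>"
proof
  interpret almost_disjoint_family I \<B>
    by (rule assms(1))
  fix A assume A: "A \<in> \<A>"
  show "A \<subseteq> I" "uncountable A"
    using sub unc subsetD[OF assms(2) A] by simp_all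
  show "countable (A \<inter> B)" if "B \<in> \<A>" "A \<noteq> B" for B
    using ad[of A B] subsetD[OF assms(2)] A that by simp
qed

text \<open>Each member of \<open>\<B>\<close> is almost disjoint from all of \<open>\<A>\<close>,
  so \<open>B \<inter> S\<close> is the uncountable set required.\<close>

lemma Whyburn_mrowka_of_pair:
  assumes fam: "almost_disjoint_family I (\<A> \<union> \<B>)" and disj: "\<A> \<inter> \<B> = {}"
    and pos: "\<And>S. S \<subseteq> I \<Longrightarrow> S \<notin> sigma_ideal \<A> \<Longrightarrow> \<exists>B\<in>\<B>. uncountable (B \<inter> S)"
  shows "Whyburn_space (mrowka I \<A>)"
proof (rule almost_disjoint_family.Whyburn_mrowka)
  show "almost_disjoint_family I \<A>"
    using fam by (rule almost_disjoint_family_subset) simp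
  fix S assume "S \<subseteq> I" "S \<notin> sigma_ideal \<A>"
  then obtain B where B: "B \<in> \<B>" "uncountable (B \<inter> S)"
    using pos by metis
  have "countable (A \<inter> (B \<inter> S))" if "A \<in> \<A>" for A
  proof -
    have "A \<noteq> B"
      using that B(1) disj by auto
    then have "countable (A \<inter> B)"
      using that B(1) by (intro almost_disjoint_family.ad[OF fam]) simp_all
    then show ?thesis
      by (rule countable_subset[rotated]) auto
  qed
  then show "\<exists>F\<subseteq>S. uncountable F \<and> (\<forall>A\<in>\<A>. countable (A \<inter> F))"
    using B(2) by (intro exI[of _ "B \<inter> S"]) simp
qed

text \<open>As \<open>A\<close> is almost disjoint from all of \<open>\<B>\<close>, the
  neighbourhood \<open>V\<close> of infinity omits only countably many points of \<open>A\<close>,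
  and so does \<open>U\<close>. Hence the diagonal over \<open>S\<close> accumulates at
  \<open>(A, {})\<close>.\<close>

lemma nbhds_meet_on_trace:
  assumes fam: "almost_disjoint_family I (\<A> \<union> \<B>)" and disj: "\<A> \<inter> \<B> = {}"
    and A: "A \<in> \<A>" and S: "S \<subseteq> I" "uncountable (A \<inter> S)"
    and U: "openin (mrowka I \<A>) U" "A \<in> U" and V: "openin (mrowka I \<B>) V" "{} \<in> V"
  shows "\<exists>i\<in>S. {i} \<in> U \<and> {i} \<in> V"
proof (rule ccontr)
  assume none: "\<not> ?thesis"
  let ?W = "A \<inter> {i \<in> I. {i} \<notin> V}"
  have "?W \<in> sigma_ideal \<B>"
    using openin_mrowkaD(4)[OF V] by (rule sigma_ideal_subset) simp
  moreover have "countable (B \<inter> ?W)" if "B \<in> \<B>" for B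
  proof -
    have "B \<noteq> A"
      using that A disj by auto
    then have "countable (B \<inter> A)"
      using that A by (intro almost_disjoint_family.ad[OF fam]) simp_all
    then show ?thesis
      by (rule countable_subset[rotated]) auto
  qed
  ultimately have "countable ?W"
    by (rule sigma_ideal_countable)
  then have "countable ({i \<in> A. {i} \<notin> U} \<union> ?W)"
    using openin_mrowkaD(2)[OF U(1) A U(2)] by simp
  moreover have "A \<inter> S \<subseteq> {i \<in> A. {i} \<notin> U} \<union> ?W"
    using none S(1) by auto
  ultimately have "countable (A \<inter> S)"
    by (rule countable_subset[rotated])
  then show False
    using S(2) by simp
qed

lemma not_Whyburn_prod_mrowka:
  assumes fam: "almost_disjoint_family I (\<A> \<union> \<B>)" and disj: "\<A> \<inter> \<B> = {}"
    and I_pos: "I \<notin> sigma_ideal (\<A> \<union> \<B>)"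
    and pos: "\<And>S. S \<subseteq> I \<Longrightarrow> S \<notin> sigma_ideal \<A> \<Longrightarrow> \<exists>B\<in>\<B>. uncountable (B \<inter> S)"
  shows "\<not> Whyburn_space (prod_topology (mrowka I \<A>) (mrowka I \<B>))"
proof
  let ?X = "mrowka I \<A>" and ?Y = "mrowka I \<B>"
  let ?P = "prod_topology ?X ?Y"
  let ?d = "\<lambda>i. ({i}, {i})"
  interpret X: almost_disjoint_family I \<A>
    using fam by (rule almost_disjoint_family_subset) simp
  interpret Y: almost_disjoint_family I \<B>
    using fam by (rule almost_disjoint_family_subset) simp
  have top: "?d ` I \<subseteq> topspace ?P"
    unfolding topspace_prod_topology X.topspace_mrowka Y.topspace_mrowka by auto
  have infX: "{} \<in> topspace ?X" and infY: "{} \<in> topspace ?Y"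
    unfolding X.topspace_mrowka Y.topspace_mrowka by simp_all
  \<comment> \<open>Both neighbourhoods omit sets in the ideal of \<open>\<A> \<union> \<B>\<close>,
    and these cannot exhaust \<open>I\<close>.\<close>
  have cl: "({}, {}) \<in> (?P closure_of (?d ` I)) - ?d ` I"
  proof
    show "({}, {}) \<in> ?P closure_of (?d ` I)"
    proof (rule in_prod_closure_ofI[OF infX infY])
      fix U V assume U: "openin ?X U" "{} \<in> U" and V: "openin ?Y V" "{} \<in> V"
      have "{i \<in> I. {i} \<notin> U} \<union> {i \<in> I. {i} \<notin> V} \<in> sigma_ideal (\<A> \<union> \<B>)"
        using openin_mrowkaD(4)[OF U] openin_mrowkaD(4)[OF V]
          sigma_ideal_mono[of \<A> "\<A> \<union> \<B>"] sigma_ideal_mono[of \<B> "\<A> \<union> \<B>"]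
        by (intro sigma_ideal_Un) auto
      then have "\<not> I \<subseteq> {i \<in> I. {i} \<notin> U} \<union> {i \<in> I. {i} \<notin> V}"
        using I_pos sigma_ideal_subset[of _ "\<A> \<union> \<B>" I] by auto
      then show "?d ` I \<inter> (U \<times> V) \<noteq> {}"
        by auto
    qed
  qed auto
  then have not_closed: "\<not> closedin ?P (?d ` I)"
    using closure_of_closedin[of ?P "?d ` I"] by auto
  assume "Whyburn_space ?P"
  then have "\<exists>F\<subseteq>?d ` I. almost_closed_to ?P F ({}, {})"
    unfolding Whyburn_space_def using top not_closed cl by (elim allE[of _ "?d ` I"]) simp
  then obtain F where F: "F \<subseteq> ?d ` I" "almost_closed_to ?P F ({}, {})"
    by (elim exE conjE)
  have Fcl: "?P closure_of F - F = {({}, {})}"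
    using F(2) unfolding almost_closed_to_def by simp
  define S where "S = {i \<in> I. ?d i \<in> F}"
  have SI: "S \<subseteq> I"
    unfolding S_def by auto
  \<comment> \<open>If \<open>S\<close> were countable, a neighbourhood of infinity in the first
    factor would avoid it.\<close>
  have S_unc: "uncountable S"
  proof
    assume "countable S"
    then have "S \<in> sigma_ideal \<A>"
      by (rule countable_in_sigma_ideal)
    then obtain U where U: "openin ?X U" "{} \<in> U" "\<And>i. i \<in> S \<Longrightarrow> {i} \<notin> U"
      using X.openin_infinity_avoiding[OF countable_empty empty_subsetI] by metis
    have "openin ?P (U \<times> topspace ?Y)"
      unfolding openin_prod_Times_iff using U(1) by simp
    moreover have "({}, {}) \<in> ?P closure_of F"
      using Fcl by auto
    moreover have "({}, {}) \<in> U \<times> topspace ?Y"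
      using U(2) infY by simp
    ultimately obtain p where p: "p \<in> F" "p \<in> U \<times> topspace ?Y"
      unfolding in_closure_of by metis
    then show False
      using U(3) F(1) unfolding S_def by auto
  qed
  \<comment> \<open>This is the maximality of \<open>\<A> \<union> \<B>\<close>: an uncountable set
    in the ideal of \<open>\<A>\<close> meets a member of \<open>\<A>\<close> uncountably, and
    \<open>pos\<close> covers the rest.\<close>
  have "\<exists>B\<in>\<A> \<union> \<B>. uncountable (B \<inter> S)"
  proof (cases "S \<in> sigma_ideal \<A>")
    case True
    then show ?thesis
      using S_unc sigma_ideal_countable[OF True] by (metis UnI1)
  next
    case False
    then show ?thesis
      using pos[OF SI] by (metis UnI2)
  qed
  then consider A where "A \<in> \<A>" "uncountable (A \<inter> S)" | B where "B \<in> \<B>" "uncountable (B \<inter> S)"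
    by (metis UnE)
  then show False
  proof cases
    case 1
    \<comment> \<open>The closure of \<open>F\<close> may add only the pair of infinities, so a
      second new limit point is a contradiction.\<close>
    have "(A, {}) \<in> ?P closure_of F"
    proof (rule in_prod_closure_ofI[OF _ infY])
      show "A \<in> topspace ?X"
        using 1(1) unfolding X.topspace_mrowka by simp
      fix U V assume "openin ?X U" "A \<in> U" "openin ?Y V" "{} \<in> V"
      then show "F \<inter> (U \<times> V) \<noteq> {}"
        using nbhds_meet_on_trace[OF fam disj 1(1) SI 1(2)] unfolding S_def by auto
    qed
    moreover have "(A, {}) \<notin> F"
      using F(1) by auto
    ultimately have "(A, {}) \<in> {({} :: 'a set, {} :: 'a set)}"
      unfolding Fcl[symmetric] by simp
    then show False
      using 1(1) X.empty_notin by simp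
  next
    case 2
    have fam': "almost_disjoint_family I (\<B> \<union> \<A>)" and disj': "\<B> \<inter> \<A> = {}"
      using fam disj by (simp_all add: Un_commute Int_commute)
    have "({}, B) \<in> ?P closure_of F"
    proof (rule in_prod_closure_ofI[OF infX])
      show "B \<in> topspace ?Y"
        using 2(1) unfolding Y.topspace_mrowka by simp
      fix U V assume "openin ?X U" "{} \<in> U" "openin ?Y V" "B \<in> V"
      then show "F \<inter> (U \<times> V) \<noteq> {}"
        using nbhds_meet_on_trace[OF fam' disj' 2(1) SI 2(2)] unfolding S_def by auto
    qed
    moreover have "({}, B) \<notin> F"
      using F(1) by auto
    ultimately have "({}, B) \<in> {({} :: 'a set, {} :: 'a set)}"
      unfolding Fcl[symmetric] by simp
    then show False
      using 2(1) Y.empty_notin by simp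
  qed
qed

theorem corollary32:
  assumes "(BNF_Cardinal_Arithmetic.cexp BNF_Cardinal_Arithmetic.ctwo aleph1, aleph2) \<in> ordIso"
  shows "\<exists>(X :: nat set set topology) (Y :: nat set set topology).
    Hausdorff_space X \<and> Lindelof_space X \<and> Whyburn_space X \<and> P_space X \<and>
    Hausdorff_space Y \<and> Lindelof_space Y \<and> Whyburn_space Y \<and> P_space Y \<and>
    \<not> Whyburn_space (prod_topology X Y)"
proof -
  obtain \<A> \<B> where fam: "almost_disjoint_family (Field aleph1) (\<A> \<union> \<B>)" and disj: "\<A> \<inter> \<B> = {}"
    and I_pos: "Field aleph1 \<notin> sigma_ideal (\<A> \<union> \<B>)"
    and pos_A: "\<And>S. S \<subseteq> Field aleph1 \<Longrightarrow> S \<notin> sigma_ideal \<A> \<Longrightarrow> \<exists>B\<in>\<B>. uncountable (B \<inter> S)"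
    and pos_B: "\<And>S. S \<subseteq> Field aleph1 \<Longrightarrow> S \<notin> sigma_ideal \<B> \<Longrightarrow> \<exists>A\<in>\<A>. uncountable (A \<inter> S)"
    using ex_nowhere_mad_pair[OF assms] by metis
  interpret X: almost_disjoint_family "Field aleph1" \<A>
    using fam by (rule almost_disjoint_family_subset) simp
  interpret Y: almost_disjoint_family "Field aleph1" \<B>
    using fam by (rule almost_disjoint_family_subset) simp
  have "Whyburn_space (mrowka (Field aleph1) \<A>)"
    using fam disj pos_A by (rule Whyburn_mrowka_of_pair)
  moreover have "Whyburn_space (mrowka (Field aleph1) \<B>)"
  proof (rule Whyburn_mrowka_of_pair)
    show "almost_disjoint_family (Field aleph1) (\<B> \<union> \<A>)" "\<B> \<inter> \<A> = {}"
      using fam disj by (simp_all add: Un_commute Int_commute)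
  qed (rule pos_B)
  ultimately show ?thesis
    using not_Whyburn_prod_mrowka[OF fam disj I_pos pos_A]
      X.Hausdorff_mrowka X.Lindelof_mrowka X.P_space_mrowka
      Y.Hausdorff_mrowka Y.Lindelof_mrowka Y.P_space_mrowka
    by (intro exI[of _ "mrowka (Field aleph1) \<A>"] exI[of _ "mrowka (Field aleph1) \<B>"] conjI)
qed

end
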